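(* Let $m,n\geq 1$ be integers with $m+n\geq 3$, and let $K_{m,n}$ be the complete bipartite graph. Then the eigenvalues of $\tilde H_{K_{m,n}}$ are $-2m^{n-2}n^{m-2}$, $-m^{n-2}n^{m-1}$, $-m^{n-1}n^{m-2}$ and $m^{n-2}n^{m-2}(m+n-1)(m+n-2)$, and the dimensions of the corresponding eigenspaces are $(m-1)(n-1)$, $n-1$, $m-1$ and $1$, respectively.
   Context: For a connected graph $\Gamma$ with edge set $E(\Gamma)$, assign a variable $x_e$ to each edge $e$. The Kirchhoff polynomial is $F_\Gamma=\sum_{T}\prod_{e\in E(T)}x_e$, the sum over all spanning trees $T$ of $\Gamma$. The Hessian matrix of $\Gamma$ is $H_\Gamma=\left(\frac{\partial^2 F_\Gamma}{\partial x_i\partial x_j}\right)_{i,j\in E(\Gamma)}$, and $\tilde H_\Gamma$ denotes $H_\Gamma$ evaluated at $x_e=1$ for all edges $e$. $K_{m,n}$ is the complete bipartite graph with parts of sizes $m$ and $n$.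
   Formalization: When listed eigenvalues coincide (e.g. m=n, m=2 or n=2) the eigenspace dimension is the sum of the listed dimensions, and a value listed only with dimension 0 (m=1 or n=1) is not an eigenvalue; read literally the claim fails, e.g. for m=n=2, where -2 has a 3-dimensional eigenspace. *)

theory Defs
  imports "HOL-Analysis.Analysis"
begin

text \<open>
  An undirected (multi)graph with vertex set the type \<open>'v\<close> and edge set the type \<open>'e\<close>
  is given by the map sending each edge to the set of its end points.
  Sets of edges \<open>T\<close> are read as the spanning subgraphs with all vertices and edge set \<open>T\<close>.
\<close>

type_synonym ('v, 'e) ugraph = "'e \<Rightarrow> 'v set"

definition adjacency :: "('v, 'e) ugraph \<Rightarrow> 'e set \<Rightarrow> ('v \<times> 'v) set" where
  "adjacency g T = {(u, v). \<exists>e\<in>T. g e = {u, v}}"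

definition connected_edges :: "('v, 'e) ugraph \<Rightarrow> 'e set \<Rightarrow> bool" where
  "connected_edges g T \<longleftrightarrow> (\<forall>u v. (u, v) \<in> (adjacency g T)\<^sup>*)"

text \<open>
  A cycle visits pairwise distinct vertices \<open>vs\<close> through pairwise distinct edges \<open>es\<close>;
  length 1 is a loop and length 2 a pair of parallel edges.
\<close>

definition is_cycle :: "('v, 'e) ugraph \<Rightarrow> 'e set \<Rightarrow> 'v list \<Rightarrow> 'e list \<Rightarrow> bool" where
  "is_cycle g T vs es \<longleftrightarrow>
     es \<noteq> [] \<and> length vs = length es \<and> distinct vs \<and> distinct es \<and> set es \<subseteq> T \<and>
     (\<forall>i<length es. g (es ! i) = {vs ! i, vs ! (Suc i mod length es)})"

definition spanning_tree :: "('v, 'e) ugraph \<Rightarrow> 'e set \<Rightarrow> bool" where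
  "spanning_tree g T \<longleftrightarrow> connected_edges g T \<and> (\<nexists>vs es. is_cycle g T vs es)"

definition kirchhoff :: "('v, 'e::finite) ugraph \<Rightarrow> ('e \<Rightarrow> real) \<Rightarrow> real" where
  "kirchhoff g x = (\<Sum>T\<in>{T. spanning_tree g T}. \<Prod>e\<in>T. x e)"

definition partial_deriv :: "'e \<Rightarrow> (('e \<Rightarrow> real) \<Rightarrow> real) \<Rightarrow> ('e \<Rightarrow> real) \<Rightarrow> real" where
  "partial_deriv i f x = deriv (\<lambda>t. f (x(i := t))) (x i)"

definition hessian :: "('v, 'e::finite) ugraph \<Rightarrow> ('e \<Rightarrow> real) \<Rightarrow> real ^ 'e ^ 'e" where
  "hessian g x = (\<chi> i j. partial_deriv i (partial_deriv j (kirchhoff g)) x)"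

definition hessian_at_one :: "('v, 'e::finite) ugraph \<Rightarrow> real ^ 'e ^ 'e" where
  "hessian_at_one g = hessian g (\<lambda>_. 1)"

definition complete_bipartite :: "('m + 'n, 'm \<times> 'n) ugraph" where
  "complete_bipartite = (\<lambda>(a, b). {Inl a, Inr b})"

definition eigenspace :: "real ^ 'e ^ 'e \<Rightarrow> real \<Rightarrow> (real ^ 'e) set" where
  "eigenspace A c = {v. A *v v = c *\<^sub>R v}"

definition is_eigenvalue :: "real ^ 'e ^ 'e \<Rightarrow> real \<Rightarrow> bool" where
  "is_eigenvalue A c \<longleftrightarrow> (\<exists>v. v \<noteq> 0 \<and> A *v v = c *\<^sub>R v)"

text \<open>
  \<open>has_spectrum A L\<close>: the eigenvalues of \<open>A\<close> with the dimensions of their eigenspaces are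
  those listed in \<open>L\<close>. As usual for such lists with parameters, an entry with dimension 0
  stands for no eigenvalue, and the dimensions of entries with the same value add up.
\<close>

definition has_spectrum :: "real ^ 'e ^ 'e \<Rightarrow> (real \<times> nat) list \<Rightarrow> bool" where
  "has_spectrum A L \<longleftrightarrow>
     {c. is_eigenvalue A c} = {c. \<exists>d>0. (c, d) \<in> set L} \<and>
     (\<forall>c. dim (eigenspace A c) = (\<Sum>(l, d)\<leftarrow>L. if l = c then d else 0))"

end

theory Submission
  imports Defs
begin

text \<open>
  By the matrix-tree theorem, \<open>F(x) = det (L(x) + J) / (m + n)\<^sup>2\<close> with \<open>L(x)\<close> the weighted Laplacian and
  \<open>J\<close> the all-ones matrix. Changing the weights of two edges \<open>e\<close>, \<open>f\<close> is a rank-two update, so the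
  matrix determinant lemma gives \<open>H(e,f) = F(1) (Y(e,e) Y(f,f) - Y(e,f)\<^sup>2)\<close>, where
  \<open>Y(e,f) = b\<^sub>e\<^sup>T (L(1) + J)\<^sup>-\<^sup>1 b\<^sub>f\<close> and \<open>b\<^sub>e\<close> is the incidence vector of \<open>e\<close>. For the complete bipartite
  graph \<open>L(1) + J\<close> is block diagonal, and \<open>H\<close> becomes a combination of \<open>J \<otimes> J\<close>, \<open>I \<otimes> J\<close>, \<open>J \<otimes> I\<close> and
  \<open>I \<otimes> I\<close>. Such a matrix is diagonal in the basis of tensor products of constant vectors with
  differences of unit vectors.

  The matrix-tree theorem itself follows by expanding the determinant along rows into a sum over maps
  \<open>p\<close> from vertices to vertices: the term of \<open>p\<close> survives iff iterating \<open>p\<close> leads every vertex to the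
  root, and such maps are the parent maps of the spanning trees.
\<close>

section \<open>Spanning trees and parent maps\<close>

lemma adjacency_sym: "sym (adjacency g T)"
  by (auto simp: sym_def adjacency_def insert_commute)

lemma adjacency_mono: "S \<subseteq> T \<Longrightarrow> adjacency g S \<subseteq> adjacency g T"
  by (auto simp: adjacency_def)

lemma connected_edges_mono: "connected_edges g S \<Longrightarrow> S \<subseteq> T \<Longrightarrow> connected_edges g T"
  unfolding connected_edges_def by (meson adjacency_mono rtrancl_mono subsetD)

text \<open>A shortest walk from \<open>u\<close> to \<open>v\<close> avoiding \<open>e\<close>
  repeats no vertex, and \<open>e\<close> closes it to a cycle. For \<open>u = v\<close> the walk
  has length 0 and the cycle is the loop \<open>e\<close>.\<close>

lemma cycle_if_connected_without_edge:
  assumes e: "e \<in> T" "g e = {u, v}" and conn: "(u, v) \<in> (adjacency g (T - {e}))\<^sup>*"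
  shows "\<exists>vs es. is_cycle g T vs es"
proof -
  let ?R = "adjacency g (T - {e})"
  define k where "k = (LEAST k. (u, v) \<in> ?R ^^ k)"
  have k: "(u, v) \<in> ?R ^^ k"
    unfolding k_def using conn by (metis LeastI rtrancl_power)
  have k_min: "k \<le> l" if "(u, v) \<in> ?R ^^ l" for l
    unfolding k_def using that by (rule Least_le)
  obtain f where f: "f 0 = u" "f k = v" "\<And>i. i < k \<Longrightarrow> (f i, f (Suc i)) \<in> ?R"
    using k by (auto simp: relpow_fun_conv)
  have seg: "(f i, f j) \<in> ?R ^^ (j - i)" if "i \<le> j" "j \<le> k" for i j
    unfolding relpow_fun_conv using that f(3) by (intro exI[of _ "\<lambda>l. f (i + l)"]) auto
  have "f i \<noteq> f j" if ij: "i < j" "j \<le> k" for i j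
  proof
    assume "f i = f j"
    then have "(u, v) \<in> ?R ^^ (i + (k - j))"
      unfolding relpow_add using seg[of 0 i] seg[of j k] ij f(1,2) by auto
    from k_min[OF this] ij show False by linarith
  qed
  then have inj_f: "f i = f j \<longleftrightarrow> i = j" if "i \<le> k" "j \<le> k" for i j
    using that by (metis linorder_neqE_nat)
  obtain E where E: "\<And>i. i < k \<Longrightarrow> E i \<in> T - {e} \<and> g (E i) = {f i, f (Suc i)}"
  proof -
    have "\<forall>i<k. \<exists>e'. e' \<in> T - {e} \<and> g e' = {f i, f (Suc i)}"
      using f(3) unfolding adjacency_def by blast
    with that show ?thesis by metis
  qed
  have inj_E: "i = j" if "i < k" "j < k" "E i = E j" for i j
  proof -
    have "{f i, f (Suc i)} = {f j, f (Suc j)}"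
      using E that by metis
    then show ?thesis
      using inj_f that by (auto simp: doubleton_eq_iff)
  qed
  let ?vs = "map f [0..<Suc k]" and ?es = "map E [0..<k] @ [e]"
  have "is_cycle g T ?vs ?es"
    unfolding is_cycle_def
  proof (intro conjI allI impI)
    show "distinct ?vs"
      using inj_f by (simp add: distinct_map inj_on_def del: upt_Suc)
    show "distinct ?es"
      using inj_E E by (fastforce simp: distinct_map inj_on_def)
    show "set ?es \<subseteq> T"
      using E e by auto
    fix i assume "i < length ?es"
    then consider "i < k" | "i = k" by fastforce
    then show "g (?es ! i) = {?vs ! i, ?vs ! (Suc i mod length ?es)}"
      by cases (use E e f in \<open>auto simp: nth_append insert_commute simp del: upt_Suc\<close>)
  qed auto
  then show ?thesis by blast
qed

text \<open>These encode spanning trees rooted at \<open>r\<close>. Making \<open>r\<close> a fixed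
  point keeps the iterates of \<open>p\<close> at the root once they reach it.\<close>

definition parent_maps :: "('v, 'e) ugraph \<Rightarrow> 'v \<Rightarrow> ('v \<Rightarrow> 'v) set" where
  "parent_maps g r =
     {p. p r = r \<and> (\<forall>v. v \<noteq> r \<longrightarrow> {v, p v} \<in> range g) \<and> (\<forall>v. \<exists>k. (p ^^ k) v = r)}"

definition parent_edges :: "('v, 'e) ugraph \<Rightarrow> 'v \<Rightarrow> ('v \<Rightarrow> 'v) \<Rightarrow> 'e set" where
  "parent_edges g r p = {e. \<exists>v. v \<noteq> r \<and> g e = {v, p v}}"

definition depth :: "'v \<Rightarrow> ('v \<Rightarrow> 'v) \<Rightarrow> 'v \<Rightarrow> nat" where
  "depth r p v = (LEAST k. (p ^^ k) v = r)"

lemma parent_maps_edge: "p \<in> parent_maps g r \<Longrightarrow> v \<noteq> r \<Longrightarrow> \<exists>e. g e = {v, p v}"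
  unfolding parent_maps_def by (simp add: image_iff) metis

lemma parent_maps_reach: "p \<in> parent_maps g r \<Longrightarrow> \<exists>k. (p ^^ k) v = r"
  unfolding parent_maps_def by blast

lemma depth_parent:
  assumes "p \<in> parent_maps g r" and "v \<noteq> r"
  shows "depth r p v = Suc (depth r p (p v))"
proof -
  obtain k where "(p ^^ k) v = r" using parent_maps_reach[OF assms(1)] by blast
  then have "depth r p v = Suc (LEAST m. (p ^^ Suc m) v = r)"
    unfolding depth_def using assms(2) by (intro Least_Suc) auto
  then show ?thesis
    unfolding depth_def by (simp only: funpow_Suc_right o_apply)
qed

lemma parent_edges_connected:
  assumes "p \<in> parent_maps g r"
  shows "connected_edges g (parent_edges g r p)"
proof -
  let ?R = "adjacency g (parent_edges g r p)"
  have step: "(v, p v) \<in> ?R\<^sup>*" for v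
  proof (cases "v = r")
    case False
    then obtain e where "g e = {v, p v}"
      using parent_maps_edge[OF assms] by blast
    with False show ?thesis
      unfolding adjacency_def parent_edges_def by (intro r_into_rtrancl) auto
  qed (use assms in \<open>auto simp: parent_maps_def\<close>)
  have "(v, (p ^^ k) v) \<in> ?R\<^sup>*" for v k
    by (induction k) (auto intro: rtrancl_trans step)
  then have to_r: "(v, r) \<in> ?R\<^sup>*" for v
    using parent_maps_reach[OF assms] by metis
  then have "(r, v) \<in> ?R\<^sup>*" for v
    by (meson adjacency_sym sym_rtrancl symD)
  with to_r show ?thesis
    unfolding connected_edges_def by (meson rtrancl_trans)
qed

section \<open>Bijection between parent maps and spanning trees\<close>

locale finite_simple_graph =
  fixes g :: "('v::finite, 'e::finite) ugraph"
  assumes inj_ends: "inj g" and card_ends: "card (g e) = 2"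
begin

lemma ends_distinct: "g e = {u, v} \<Longrightarrow> u \<noteq> v"
  using card_ends[of e] by auto

lemma parent_edges_acyclic:
  assumes p: "p \<in> parent_maps g r"
  shows "\<not> is_cycle g (parent_edges g r p) vs es"
proof
  assume cyc: "is_cycle g (parent_edges g r p) vs es"
  define N where "N = length es"
  have N: "N > 0" "length vs = N" "distinct es" "distinct vs"
    and es: "\<And>i. i < N \<Longrightarrow> es ! i \<in> parent_edges g r p"
    and ends: "\<And>i. i < N \<Longrightarrow> g (es ! i) = {vs ! i, vs ! (Suc i mod N)}"
    using cyc unfolding is_cycle_def N_def by (auto simp: subset_iff)
  have depth: "depth r p v = Suc (depth r p (p v))" if "v \<noteq> r" for v
    using depth_parent[OF p that] .
  \<comment> \<open>Both cycle edges at a deepest vertex must be the edge to its parent.\<close>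
  define d where "d = Max ((\<lambda>i. depth r p (vs ! i)) ` {..<N})"
  have "d \<in> (\<lambda>i. depth r p (vs ! i)) ` {..<N}"
    unfolding d_def using N by (intro Max_in) auto
  then obtain i where i: "i < N" "depth r p (vs ! i) = d" by auto
  have le_d: "depth r p (vs ! j) \<le> d" if "j < N" for j
    unfolding d_def using that by (intro Max_ge) auto
  have up: "g e = {vs ! i, p (vs ! i)}"
    if e: "e \<in> parent_edges g r p" "g e = {vs ! i, vs ! j}" "j < N" for e j
  proof -
    obtain v where v: "v \<noteq> r" "g e = {v, p v}"
      using e(1) unfolding parent_edges_def by auto
    have "v \<noteq> vs ! j \<or> p v \<noteq> vs ! i"
      using depth[OF v(1)] le_d[OF e(3)] i by auto
    with v e(2) show ?thesis by (auto simp: doubleton_eq_iff)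
  qed
  \<comment> \<open>\<open>j\<close> is the cyclic predecessor of \<open>i\<close>, so
    \<open>es ! j\<close> is the other cycle edge at \<open>vs ! i\<close>. Once the two edges
    coincide, \<open>i = j\<close>, and the edge would be a loop.\<close>
  define j where "j = (if i = 0 then N - 1 else i - 1)"
  have j: "j < N" "Suc j mod N = i"
    unfolding j_def using i N by auto
  have "g (es ! i) = {vs ! i, p (vs ! i)}"
    using i N es ends by (intro up[of _ "Suc i mod N"]) auto
  moreover have "g (es ! j) = {vs ! i, p (vs ! i)}"
    using i j N es ends[of j] by (intro up[of _ j]) auto
  ultimately have "es ! i = es ! j"
    using inj_ends by (metis injD)
  then have "i = j"
    using N i j N_def by (simp add: nth_eq_iff_index_eq)
  then show False
    using ends[OF j(1)] j(2) ends_distinct by fastforce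
qed

text \<open>By induction on depth. The edge from \<open>v\<close> to \<open>p v\<close> is also an
  edge of \<open>q\<close>, with one of its ends as the child. If \<open>p v\<close> were the child,
  then by induction \<open>p\<close> would send it to \<open>v\<close> too, and each end would be
  deeper than the other.\<close>

lemma inj_on_parent_edges: "inj_on (parent_edges g r) (parent_maps g r)"
proof
  fix p q assume p: "p \<in> parent_maps g r" and q: "q \<in> parent_maps g r"
    and eq: "parent_edges g r p = parent_edges g r q"
  have depth: "depth r p v = Suc (depth r p (p v))" if "v \<noteq> r" for v
    using depth_parent[OF p that] .
  have "p v = q v" for v
  proof (induction "depth r p v" arbitrary: v rule: less_induct)
    case less
    show ?case
    proof (cases "v = r")
      case False
      then obtain e where e: "g e = {v, p v}"
        using parent_maps_edge[OF p] by blast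
      with False have "e \<in> parent_edges g r p"
        unfolding parent_edges_def by blast
      then have "e \<in> parent_edges g r q"
        unfolding eq .
      then obtain w where w: "w \<noteq> r" "{v, p v} = {w, q w}"
        using e unfolding parent_edges_def by (simp only: mem_Collect_eq) metis
      have "\<not> (w = p v \<and> v = q w)"
      proof
        assume *: "w = p v \<and> v = q w"
        then have "depth r p w < depth r p v"
          using depth[OF False] by (metis lessI)
        with less[of w] * have "depth r p (p w) = depth r p v"
          by metis
        with \<open>depth r p w < depth r p v\<close> depth[OF w(1)] show False by linarith
      qed
      with w(2) show ?thesis by (metis doubleton_eq_iff)
    qed (use p q in \<open>auto simp: parent_maps_def\<close>)
  qed
  then show "p = q" by blast
qed

text \<open>Let each vertex point to a neighbour in \<open>T\<close> that is closer to
  \<open>r\<close>. The edges so chosen lie in \<open>T\<close> and connect all vertices, so a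
  further edge of \<open>T\<close> would close a cycle.\<close>

lemma spanning_tree_imp_parent_edges:
  assumes T: "spanning_tree g T"
  shows "\<exists>p \<in> parent_maps g r. parent_edges g r p = T"
proof -
  let ?R = "adjacency g T"
  define d where "d v = (LEAST k. (v, r) \<in> ?R ^^ k)" for v
  have d: "(v, r) \<in> ?R ^^ d v" for v
    unfolding d_def using T
    by (metis LeastI connected_edges_def rtrancl_power spanning_tree_def)
  have d_le: "d v \<le> k" if "(v, r) \<in> ?R ^^ k" for v k
    unfolding d_def using that by (rule Least_le)
  have "\<exists>w. (v, w) \<in> ?R \<and> d w < d v" if "v \<noteq> r" for v
  proof -
    obtain k where k: "d v = Suc k"
      using d[of v] \<open>v \<noteq> r\<close> by (metis empty_iff not0_implies_Suc pair_in_Id_conv relpow.simps(1))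
    with d[of v] obtain w where "(v, w) \<in> ?R" "(w, r) \<in> ?R ^^ k"
      by (metis relpow_Suc_D2)
    with d_le k show ?thesis by (metis le_imp_less_Suc)
  qed
  then obtain q where q: "\<And>v. v \<noteq> r \<Longrightarrow> (v, q v) \<in> ?R \<and> d (q v) < d v" by metis
  define p where "p = q(r := r)"
  have "\<exists>k. (p ^^ k) v = r" for v
  proof (induction "d v" arbitrary: v rule: less_induct)
    case less
    show ?case
    proof (cases "v = r")
      case True
      then show ?thesis by (intro exI[of _ 0]) auto
    next
      case False
      then obtain k where "(p ^^ k) (p v) = r"
        using less[of "p v"] q unfolding p_def by auto
      then show ?thesis
        by (metis funpow_Suc_right o_apply)
    qed
  qed
  then have p: "p \<in> parent_maps g r"
    using q unfolding parent_maps_def p_def adjacency_def by fastforce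
  have sub: "parent_edges g r p \<subseteq> T"
  proof
    fix e assume "e \<in> parent_edges g r p"
    then obtain v where v: "v \<noteq> r" "g e = {v, q v}"
      unfolding parent_edges_def p_def by auto
    with q obtain e' where "e' \<in> T" "g e' = {v, q v}"
      unfolding adjacency_def by blast
    with v inj_ends show "e \<in> T"
      by (metis injD)
  qed
  have "e \<in> parent_edges g r p" if "e \<in> T" for e
  proof (rule ccontr)
    assume "e \<notin> parent_edges g r p"
    with sub have "parent_edges g r p \<subseteq> T - {e}" by blast
    then have "connected_edges g (T - {e})"
      by (rule connected_edges_mono[OF parent_edges_connected[OF p]])
    moreover obtain u v where "g e = {u, v}"
      using card_ends[of e] by (meson card_2_iff)
    ultimately show False
      using cycle_if_connected_without_edge[of e T g u v] T that
      unfolding connected_edges_def spanning_tree_def by blast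
  qed
  with sub p show ?thesis by blast
qed

lemma bij_betw_parent_edges:
  "bij_betw (parent_edges g r) (parent_maps g r) {T. spanning_tree g T}"
  unfolding bij_betw_def
proof (intro conjI inj_on_parent_edges equalityI)
  show "parent_edges g r ` parent_maps g r \<subseteq> {T. spanning_tree g T}"
    using parent_edges_connected parent_edges_acyclic by (fastforce simp: spanning_tree_def)
  show "{T. spanning_tree g T} \<subseteq> parent_edges g r ` parent_maps g r"
    using spanning_tree_imp_parent_edges by fastforce
qed

end

section \<open>Rank-one updates of determinants\<close>

lemma det_eq_0_if_kernel:
  fixes A :: "'a::field ^ 'n ^ 'n"
  assumes "A *v z = 0" "z \<noteq> 0"
  shows "det A = 0"
  using assms invertible_det_nz[of A] matrix_left_invertible_ker[of A] unfolding invertible_def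
  by metis

definition outer :: "real ^ 'n \<Rightarrow> real ^ 'n \<Rightarrow> real ^ 'n ^ 'n" where
  "outer u v = (\<chi> i j. u $ i * v $ j)"

lemma matrix_add_rdistrib: "(A + B) ** C = A ** C + B ** C"
  by (simp add: vec_eq_iff matrix_matrix_mult_def distrib_right sum.distrib)

lemma matrix_mult_outer: "A ** outer u v = outer (A *v u) v"
  by (simp add: vec_eq_iff outer_def matrix_matrix_mult_def matrix_vector_mult_def
      sum_distrib_right mult.assoc)

lemma outer_mult_transpose: "outer u v ** transpose A = outer u (A *v v)"
  by (simp add: vec_eq_iff outer_def matrix_matrix_mult_def matrix_vector_mult_def transpose_def
      sum_distrib_left mult_ac)

lemma outer_vec: "outer u v *v w = (v \<bullet> w) *\<^sub>R u"
  by (simp add: vec_eq_iff outer_def matrix_vector_mult_def inner_vec_def sum_distrib_right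
      sum_distrib_left mult_ac)

text \<open>Row \<open>k\<close> being \<open>v\<close>, multiples of \<open>v\<close> in the other
  rows do not change the determinant. Clearing them one at a time leaves the identity with row
  \<open>k\<close> replaced by \<open>v\<close>.\<close>

lemma det_row_replace_mat_1:
  fixes v :: "real ^ 'n"
  assumes "finite S" "k \<notin> S"
  shows "det (\<chi> i. if i = k then v else axis i 1 + (if i \<in> S then u i else 0) *s v) = v $ k"
  using assms
proof (induction S rule: finite_induct)
  case empty
  have comb: "(\<Sum>i\<in>UNIV. v $ i *s row i (mat 1 :: real^'n^'n)) = v"
    by (simp add: vec_eq_iff row_def mat_def if_distrib cong: if_cong)
  have "det (\<chi> i. if i = k then v else row i (mat 1 :: real^'n^'n)) = v $ k"
    using cramer_lemma_transpose[of k v "mat 1 :: real^'n^'n"] unfolding comb by simp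
  moreover have "row i (mat 1 :: real^'n^'n) = axis i 1" for i
    by (simp add: vec_eq_iff row_def mat_def axis_def eq_commute)
  ultimately show ?case by (simp cong: if_cong)
next
  case (insert j S)
  let ?c = "\<lambda>i. if i = k then v else axis i 1 + (if i \<in> S then u i else 0) *s v"
  have jk: "j \<noteq> k" using insert by auto
  have "det (\<chi> i. if i = k then v else axis i 1 + (if i \<in> insert j S then u i else 0) *s v)
    = det (\<chi> i. if i = j then axis i 1 + u j *s v else ?c i)"
    using jk by (intro arg_cong[where f=det] Cart_lambda_cong) auto
  also have "\<dots> = det (\<chi> i. if i = j then axis i 1 else ?c i) + u j * det (\<chi> i. if i = j then v else ?c i)"
    by (simp only: det_row_add det_row_mul)
  also have "det (\<chi> i. if i = j then v else ?c i) = 0"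
    by (rule det_identical_rows[OF jk]) (simp add: row_def vec_eq_iff)
  also have "(\<chi> i. if i = j then axis i 1 else ?c i) = (\<chi> i. ?c i)"
    using jk insert(2) by (intro Cart_lambda_cong) auto
  finally show ?case using insert by simp
qed

text \<open>By linearity in row \<open>k\<close>, completing that row adds \<open>u $ k\<close>
  times the determinant with row \<open>k\<close> replaced by \<open>v\<close>, which is
  \<open>v $ k\<close>.\<close>

lemma det_mat_1_plus_outer: "det (mat 1 + outer u v) = 1 + v \<bullet> u"
proof -
  have "det (\<chi> i. axis i 1 + (if i \<in> S then u $ i else 0) *s v) = 1 + (\<Sum>i\<in>S. u $ i * v $ i)" for S
  proof (induction S rule: finite_induct[OF finite])
    case 1
    have "(\<chi> i. axis i 1) = (mat 1 :: real^'a^'a)"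
      by (simp add: vec_eq_iff mat_def axis_def eq_commute)
    then show ?case by simp
  next
    case (2 k S)
    let ?c = "\<lambda>i. axis i 1 + (if i \<in> S then u $ i else 0) *s v"
    have "det (\<chi> i. axis i 1 + (if i \<in> insert k S then u $ i else 0) *s v)
      = det (\<chi> i. if i = k then axis i 1 + u $ k *s v else ?c i)"
      by (intro arg_cong[where f=det] Cart_lambda_cong) auto
    also have "\<dots> = det (\<chi> i. if i = k then axis i 1 else ?c i) + u $ k * det (\<chi> i. if i = k then v else ?c i)"
      by (simp only: det_row_add det_row_mul)
    also have "det (\<chi> i. if i = k then v else ?c i) = v $ k"
      by (rule det_row_replace_mat_1) (use 2 in auto)
    also have "(\<chi> i. if i = k then axis i 1 else ?c i) = (\<chi> i. ?c i)"
      using 2(2) by (intro Cart_lambda_cong) auto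
    finally show ?case using 2 by simp
  qed
  from this[of UNIV] have "det (\<chi> i. axis i 1 + u $ i *s v) = 1 + v \<bullet> u"
    by (simp add: inner_vec_def mult.commute)
  also have "(\<chi> i. axis i 1 + u $ i *s v) = mat 1 + outer u v"
    by (simp add: vec_eq_iff outer_def mat_def axis_def eq_commute)
  finally show ?thesis .
qed

text \<open>The matrix determinant lemma, through the factorisation
  \<open>A ** (mat 1 + outer y v)\<close>. The vector \<open>y\<close> stands for the inverse of
  \<open>A\<close> applied to \<open>u\<close>.\<close>

lemma det_plus_outer:
  assumes "A *v y = u"
  shows "det (A + outer u v) = det A * (1 + v \<bullet> y)"
proof -
  have "A + outer u v = A ** (mat 1 + outer y v)"
    by (simp add: matrix_add_ldistrib matrix_mult_outer assms)
  then show ?thesis by (simp add: det_mul det_mat_1_plus_outer)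
qed

lemma det_plus_outer_outer:
  assumes u: "A *v y1 = u1" "A *v y2 = u2" and nz: "1 + v1 \<bullet> y1 \<noteq> 0"
  shows "det (A + outer u1 v1 + outer u2 v2) =
    det A * ((1 + v1 \<bullet> y1) * (1 + v2 \<bullet> y2) - (v1 \<bullet> y2) * (v2 \<bullet> y1))"
proof -
  \<comment> \<open>The Sherman-Morrison correction of \<open>y2\<close>: it solves the system for
    \<open>A + outer u1 v1\<close> with right side \<open>u2\<close>, so the rank-one formula can be
    applied a second time.\<close>
  define z where "z = y2 - ((v1 \<bullet> y2) / (1 + v1 \<bullet> y1)) *\<^sub>R y1"
  have v1z: "v1 \<bullet> z = (v1 \<bullet> y2) / (1 + v1 \<bullet> y1)"
    unfolding z_def using nz by (simp add: inner_diff_right field_simps)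
  have "(A + outer u1 v1) *v z = A *v z + (v1 \<bullet> z) *\<^sub>R u1"
    by (simp add: matrix_vector_mult_add_rdistrib outer_vec)
  also have "A *v z = u2 - (v1 \<bullet> z) *\<^sub>R u1"
    unfolding v1z unfolding z_def by (simp add: matrix_vector_mult_diff_distrib matrix_vector_mult_scaleR u)
  finally have "(A + outer u1 v1) *v z = u2" by simp
  then have "det (A + outer u1 v1 + outer u2 v2) = det A * (1 + v1 \<bullet> y1) * (1 + v2 \<bullet> z)"
    by (simp add: det_plus_outer det_plus_outer[OF u(1)])
  also have "\<dots> = det A * ((1 + v1 \<bullet> y1) * (1 + v2 \<bullet> y2) - (v1 \<bullet> y2) * (v2 \<bullet> y1))"
    unfolding z_def using nz by (simp add: inner_diff_right field_simps)
  finally show ?thesis .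
qed

section \<open>The matrix-tree theorem\<close>

lemma funpow_fixed: "p r = r \<Longrightarrow> (p ^^ k) r = r"
  by (induction k) auto

text \<open>If \<open>p\<close> leads every vertex to \<open>r\<close>, the matrix is unitriangular
  for the order by distance to \<open>r\<close>, so only the identity permutation contributes.
  Otherwise the indicator of the vertices that never reach \<open>r\<close> lies in the
  kernel.\<close>

lemma det_parent_map:
  fixes p :: "'v::finite \<Rightarrow> 'v"
  assumes pr: "p r = r"
  shows "det ((\<chi> v. if v = r then axis r 1 else axis v 1 - axis (p v) 1) :: real ^ 'v ^ 'v) =
    (if \<forall>v. \<exists>k. (p ^^ k) v = r then 1 else 0)"
proof -
  let ?A = "(\<chi> v. if v = r then axis r 1 else axis v 1 - axis (p v) 1) :: real ^ 'v ^ 'v"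
  show ?thesis
  proof (cases "\<forall>v. \<exists>k. (p ^^ k) v = r")
    case True
    have only_id: "q = id" if q: "q permutes UNIV" and nz: "(\<Prod>v\<in>UNIV. ?A $ v $ q v) \<noteq> 0" for q
    proof -
      have nz': "?A $ v $ q v \<noteq> 0" for v
        using nz by auto
      have "q r = r"
        using nz'[of r] by (simp add: axis_def split: if_splits)
      \<comment> \<open>For \<open>v\<close> other than \<open>r\<close>, \<open>q v\<close> is
        \<open>v\<close> or \<open>p v\<close>; as \<open>q\<close> already fixes \<open>p v\<close>
        by induction, injectivity leaves only \<open>v\<close>.\<close>
      have "(p ^^ k) v = r \<Longrightarrow> q v = v" for k v
      proof (induction k arbitrary: v)
        case (Suc k)
        then have "q (p v) = p v"
          by (simp add: funpow_swap1)
        moreover have "v = r \<or> q v = v \<or> q v = p v"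
          using nz'[of v] by (auto simp: axis_def split: if_splits)
        moreover have "inj q" using permutes_inj[OF q] .
        ultimately show ?case using \<open>q r = r\<close> by (metis injD)
      qed (use \<open>q r = r\<close> in auto)
      with True show ?thesis by (auto simp: fun_eq_iff)
    qed
    have diag: "?A $ v $ v = 1" for v
    proof (cases "v = r")
      case False
      have "p v \<noteq> v"
        using True False by (metis funpow_fixed)
      with False show ?thesis by (simp add: axis_def)
    qed (simp add: axis_def)
    have "det ?A = (\<Sum>q\<in>{id}. of_int (sign q) * (\<Prod>v\<in>UNIV. ?A $ v $ q v))"
      unfolding det_def
      by (rule sum.mono_neutral_right) (use only_id permutes_id in \<open>auto simp del: vec_lambda_beta\<close>)
    also have "\<dots> = 1"
      by (simp add: diag sign_id del: vec_lambda_beta)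
    finally show ?thesis using True by simp
  next
    case False
    define z where "z = (\<chi> v. if (\<exists>k. (p ^^ k) v = r) then 0 else (1 :: real))"
    have z_p: "z $ p v = z $ v" for v
    proof -
      have "(\<exists>k. (p ^^ k) (p v) = r) \<longleftrightarrow> (\<exists>k. (p ^^ k) v = r)"
      proof
        assume "\<exists>k. (p ^^ k) (p v) = r"
        then show "\<exists>k. (p ^^ k) v = r" by (metis funpow_Suc_right o_apply)
      next
        assume "\<exists>k. (p ^^ k) v = r"
        then show "\<exists>k. (p ^^ k) (p v) = r" by (metis funpow_swap1 pr)
      qed
      then show ?thesis by (simp add: z_def)
    qed
    have z_r: "z $ r = 0"
      unfolding z_def by (auto intro!: exI[of _ 0])
    have "(?A *v z) $ v = 0" for v
      by (simp add: matrix_vector_mul_component inner_diff_left inner_axis' z_p z_r)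
    then have "?A *v z = 0" by (simp add: vec_eq_iff)
    moreover have "z \<noteq> 0"
      using False by (auto simp: z_def vec_eq_iff)
    ultimately have "det ?A = 0"
      by (rule det_eq_0_if_kernel)
    with False show ?thesis by simp
  qed
qed

section \<open>Weighted Laplacians and their determinants\<close>

definition edge_weight :: "('v, 'e::finite) ugraph \<Rightarrow> ('e \<Rightarrow> real) \<Rightarrow> 'v \<Rightarrow> 'v \<Rightarrow> real" where
  "edge_weight g x u v = (\<Sum>e | g e = {u, v}. x e)"

definition laplacian :: "('v::finite, 'e::finite) ugraph \<Rightarrow> ('e \<Rightarrow> real) \<Rightarrow> real ^ 'v ^ 'v" where
  "laplacian g x =
     (\<chi> u v. (if u = v then \<Sum>w\<in>UNIV. edge_weight g x u w else 0) - edge_weight g x u v)"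

lemma laplacian_row:
  "laplacian g x $ u = (\<Sum>w\<in>UNIV. edge_weight g x u w *s (axis u 1 - axis w 1))"
  by (simp add: vec_eq_iff laplacian_def axis_def right_diff_distrib sum_subtractf
      if_distrib[of "\<lambda>t. _ * t"] cong: if_cong)

lemma laplacian_sym: "transpose (laplacian g x) = laplacian g x"
  by (simp add: vec_eq_iff transpose_def laplacian_def edge_weight_def insert_commute)

lemma laplacian_ones: "laplacian g x *v (\<chi> i. 1) = 0"
  by (simp add: vec_eq_iff laplacian_def matrix_vector_mult_def sum_subtractf)

context finite_simple_graph
begin

lemma edge_weight_ends: "g e = {u, v} \<Longrightarrow> edge_weight g x u v = x e"
proof -
  assume e: "g e = {u, v}"
  then have "{e. g e = {u, v}} = {e}"
    using inj_ends by (auto dest: injD)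
  then show ?thesis by (simp add: edge_weight_def)
qed

text \<open>Every vertex other than \<open>r\<close> owns the edge to its parent. No edge is owned
  twice, as its ends would be parents of each other, against the depths.\<close>

lemma prod_parent_edges:
  assumes p: "p \<in> parent_maps g r"
  shows "(\<Prod>e\<in>parent_edges g r p. x e) = (\<Prod>v\<in>-{r}. edge_weight g x v (p v))"
proof -
  have "\<exists>e. g e = {v, p v}" if "v \<noteq> r" for v
    using parent_maps_edge[OF p that] .
  then obtain E where E: "\<And>v. v \<noteq> r \<Longrightarrow> g (E v) = {v, p v}" by metis
  have "inj_on E (-{r})"
  proof
    fix v w assume vw: "v \<in> -{r}" "w \<in> -{r}" "E v = E w"
    then have "{v, p v} = {w, p w}"
      using E by (metis ComplD singletonI)
    then have "v = w \<or> v = p w \<and> w = p v"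
      by (metis doubleton_eq_iff)
    moreover have "depth r p v = Suc (depth r p (p v))" "depth r p w = Suc (depth r p (p w))"
      using depth_parent[OF p] vw by auto
    ultimately show "v = w"
      by (metis Suc_n_not_le_n nat_le_linear le_SucI order_refl)
  qed
  moreover have "parent_edges g r p = E ` (-{r})"
  proof
    show "parent_edges g r p \<subseteq> E ` (-{r})"
    proof
      fix e assume "e \<in> parent_edges g r p"
      then obtain v where "v \<noteq> r" "g e = {v, p v}"
        unfolding parent_edges_def by blast
      with E[of v] inj_ends have "e = E v" by (metis injD)
      with \<open>v \<noteq> r\<close> show "e \<in> E ` (-{r})" by simp
    qed
    show "E ` (-{r}) \<subseteq> parent_edges g r p"
      using E unfolding parent_edges_def by blast
  qed
  ultimately have "(\<Prod>e\<in>parent_edges g r p. x e) = (\<Prod>v\<in>-{r}. x (E v))"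
    by (simp add: prod.reindex)
  also have "\<dots> = (\<Prod>v\<in>-{r}. edge_weight g x v (p v))"
    by (rule prod.cong) (simp_all add: edge_weight_ends[OF E])
  finally show ?thesis .
qed

text \<open>Row \<open>r\<close> being a unit vector, this is the determinant of the Laplacian
  without row and column \<open>r\<close>.\<close>

lemma matrix_tree_row:
  "det (\<chi> v. if v = r then axis r 1 else laplacian g x $ v) = kirchhoff g x"
proof -
  let ?W = "edge_weight g x"
  let ?a = "\<lambda>v w. ?W v w *s (axis v 1 - axis w 1)"
  have "det (\<chi> v. if v = r then axis r 1 else laplacian g x $ v)
    = det (\<chi> v. if v \<in> -{r} then \<Sum>w\<in>UNIV. ?a v w else axis r 1)"
    by (intro arg_cong[where f=det] Cart_lambda_cong) (simp add: laplacian_row)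
  \<comment> \<open>Choosing one summand in each row other than \<open>r\<close> amounts to a map
    \<open>p\<close>. The expansion takes \<open>p\<close> to be the identity on the remaining row,
    hence \<open>p r = r\<close>.\<close>
  also have "\<dots> = (\<Sum>p | p r = r. det (\<chi> v. if v \<in> -{r} then ?a v (p v) else axis r 1))"
    by (subst det_linear_rows_sum_lemma) simp_all
  also have "\<dots> = (\<Sum>p | p r = r. (\<Prod>v\<in>-{r}. ?W v (p v)) * (if \<forall>v. \<exists>k. (p ^^ k) v = r then 1 else 0))"
  proof (rule sum.cong[OF refl])
    fix p assume "p \<in> {p. p r = r}"
    then have pr: "p r = r" by simp
    let ?c = "\<lambda>v. if v = r then 1 else ?W v (p v)"
    have "det (\<chi> v. if v \<in> -{r} then ?a v (p v) else axis r 1)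
      = det (\<chi> v. ?c v *s (if v = r then axis r 1 else axis v 1 - axis (p v) 1))"
      by (intro arg_cong[where f=det] Cart_lambda_cong) simp
    also have "\<dots> = prod ?c UNIV * (if \<forall>v. \<exists>k. (p ^^ k) v = r then 1 else 0)"
      by (simp only: det_rows_mul det_parent_map[where p = p and r = r, OF pr])
    also have "prod ?c UNIV = (\<Prod>v\<in>-{r}. ?W v (p v))"
      by (rule prod.mono_neutral_cong_right) auto
    finally show "det (\<chi> v. if v \<in> -{r} then ?a v (p v) else axis r 1)
      = (\<Prod>v\<in>-{r}. ?W v (p v)) * (if \<forall>v. \<exists>k. (p ^^ k) v = r then 1 else 0)" .
  qed
  also have "\<dots> = (\<Sum>p\<in>parent_maps g r. \<Prod>v\<in>-{r}. ?W v (p v))"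
  proof (rule sum.mono_neutral_cong_right)
    show "parent_maps g r \<subseteq> {p. p r = r}"
      unfolding parent_maps_def by blast
    \<comment> \<open>A map outside \<open>parent_maps g r\<close> either uses a non-edge, whose
      weight is 0, or fails to lead some vertex to \<open>r\<close>.\<close>
    show "\<forall>p\<in>{p. p r = r} - parent_maps g r.
      (\<Prod>v\<in>-{r}. ?W v (p v)) * (if \<forall>v. \<exists>k. (p ^^ k) v = r then 1 else 0) = 0"
    proof
      fix p assume p: "p \<in> {p. p r = r} - parent_maps g r"
      show "(\<Prod>v\<in>-{r}. ?W v (p v)) * (if \<forall>v. \<exists>k. (p ^^ k) v = r then 1 else 0) = 0"
      proof (cases "\<forall>v. \<exists>k. (p ^^ k) v = r")
        case True
        with p obtain v where v: "v \<noteq> r" "{v, p v} \<notin> range g"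
          unfolding parent_maps_def by blast
        then have "{e. g e = {v, p v}} = {}"
          by (metis (mono_tags, lifting) Collect_empty_eq rangeI)
        then have "?W v (p v) = 0" by (simp add: edge_weight_def)
        with v(1) show ?thesis by auto
      next
        case False
        then show ?thesis by (simp only: if_False mult_zero_right)
      qed
    qed
    fix p assume "p \<in> parent_maps g r"
    then have "\<forall>v. \<exists>k. (p ^^ k) v = r" by (simp add: parent_maps_reach)
    then show "(\<Prod>v\<in>-{r}. ?W v (p v)) * (if \<forall>v. \<exists>k. (p ^^ k) v = r then 1 else 0) =
      (\<Prod>v\<in>-{r}. ?W v (p v))"
      by simp
  qed simp
  also have "\<dots> = (\<Sum>p\<in>parent_maps g r. \<Prod>e\<in>parent_edges g r p. x e)"
    by (rule sum.cong) (simp_all add: prod_parent_edges)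
  also have "\<dots> = kirchhoff g x"
    unfolding kirchhoff_def by (rule sum.reindex_bij_betw[OF bij_betw_parent_edges])
  finally show ?thesis .
qed

text \<open>Multiplication by a matrix of determinant \<open>CARD('v)\<close> on the left and its
  transpose on the right replaces the root vector \<open>?e\<close> by the all-ones vector; this is
  where the square comes from.\<close>

theorem matrix_tree:
  "det (laplacian g x + outer (\<chi> i. 1) (\<chi> i. 1)) = real CARD('v) ^ 2 * kirchhoff g x"
proof -
  let ?L = "laplacian g x" and ?one = "(\<chi> i. 1) :: real ^ 'v"
  fix r :: 'v
  let ?e = "axis r 1 :: real ^ 'v"
  have "det ?L = 0"
    using det_eq_0_if_kernel[OF laplacian_ones] by (simp add: vec_eq_iff)
  \<comment> \<open>The update only adds \<open>?e\<close> to row \<open>r\<close>. Splitting that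
    row leaves the determinant of \<open>matrix_tree_row\<close> and that of \<open>?L\<close>,
    which vanishes.\<close>
  have "det (?L + outer ?e ?e) = det (\<chi> v. if v = r then ?e + ?L $ v else ?L $ v)"
    by (intro arg_cong[where f=det]) (simp add: vec_eq_iff outer_def axis_def)
  also have "\<dots> = kirchhoff g x + det (\<chi> v. if v = r then ?L $ v else ?L $ v)"
    unfolding det_row_add matrix_tree_row ..
  also have "det (\<chi> v. if v = r then ?L $ v else ?L $ v) = 0"
    using \<open>det ?L = 0\<close> by simp
  finally have L_e: "det (?L + outer ?e ?e) = kirchhoff g x" by simp
  \<comment> \<open>Since the columns of \<open>?L\<close> sum to zero, \<open>B\<close> fixes \<open>?L\<close>; it maps \<open>?e\<close> to \<open>?one\<close>.\<close>
  define B where "B = mat 1 + outer (?one - ?e) ?one"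
  have "det B = CARD('v)"
    unfolding B_def det_mat_1_plus_outer
    by (simp add: inner_diff_right inner_axis) (simp add: inner_vec_def)
  have outer_L: "outer u ?one ** ?L = 0" for u
  proof -
    have "(?L *v ?one) $ j = 0" for j by (simp add: laplacian_ones)
    then have "(\<Sum>k\<in>UNIV. ?L $ k $ j) = 0" for j
      by (subst laplacian_sym[symmetric]) (simp add: transpose_def matrix_vector_mult_def)
    then show ?thesis
      by (simp add: vec_eq_iff outer_def matrix_matrix_mult_def flip: sum_distrib_left)
  qed
  have B_L: "B ** ?L = ?L"
    unfolding B_def by (simp add: matrix_add_rdistrib outer_L)
  have L_B: "?L ** transpose B = ?L"
    by (metis B_L laplacian_sym matrix_transpose_mul)
  have B_e: "B *v ?e = ?one"
    unfolding B_def by (simp add: matrix_vector_mult_add_rdistrib outer_vec inner_axis)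
  have "B ** (?L + outer ?e ?e) ** transpose B = ?L + outer ?one ?one"
    by (simp add: matrix_add_ldistrib matrix_add_rdistrib B_L L_B matrix_mult_outer
        outer_mult_transpose B_e)
  then have "det (?L + outer ?one ?one) = det B * kirchhoff g x * det B"
    by (metis det_mul det_transpose L_e)
  then show ?thesis
    by (simp add: \<open>det B = CARD('v)\<close> power2_eq_square)
qed

end

section \<open>The Hessian of the complete bipartite graph\<close>

text \<open>An edge with ends \<open>u\<close> and \<open>v\<close> enters the Laplacian as its
  weight times the outer square of \<open>axis u 1 - axis v 1\<close>.\<close>

lemma laplacian_fun_upd:
  assumes e: "g e = {u, v}" "u \<noteq> v"
  shows "laplacian g (x(e := t)) =
    laplacian g x + outer ((t - x e) *\<^sub>R (axis u 1 - axis v 1)) (axis u 1 - axis v 1)"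
proof -
  have W: "edge_weight g (x(e := t)) a b =
      edge_weight g x a b + (if {u, v} = {a, b} then t - x e else 0)" for a b
  proof -
    have "edge_weight g (x(e := t)) a b =
        (\<Sum>e' | g e' = {a, b}. x e' + (if e' = e then t - x e else 0))"
      unfolding edge_weight_def by (rule sum.cong) auto
    also have "\<dots> = edge_weight g x a b + (if {u, v} = {a, b} then t - x e else 0)"
      by (simp add: edge_weight_def sum.distrib e eq_commute)
    finally show ?thesis .
  qed
  have S: "(\<Sum>w\<in>UNIV. if {u, v} = {a, w} then t - x e else 0) = (if a = u \<or> a = v then t - x e else 0)" for a
  proof -
    have "{u, v} = {a, w} \<longleftrightarrow> (if a = u then w = v else a = v \<and> w = u)" for w
      using e(2) by (auto simp: doubleton_eq_iff)
    then show ?thesis by (cases "a = u"; cases "a = v"; simp)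
  qed
  show ?thesis
    unfolding vec_eq_iff
  proof (intro allI)
    fix a b
    show "laplacian g (x(e := t)) $ a $ b =
      (laplacian g x + outer ((t - x e) *\<^sub>R (axis u 1 - axis v 1)) (axis u 1 - axis v 1)) $ a $ b"
      using e(2) by (simp add: laplacian_def W sum.distrib S outer_def axis_def)
         (auto simp: doubleton_eq_iff)
  qed
qed

lemma sum_UNIV_Plus:
  "(\<Sum>w\<in>UNIV. f w) = (\<Sum>a\<in>UNIV. f (Inl a)) + (\<Sum>b\<in>UNIV. f (Inr b))"
  for f :: "'a::finite + 'b::finite \<Rightarrow> 'c::comm_monoid_add"
  by (simp add: sum.Plus flip: UNIV_Plus_UNIV)

lemma prod_UNIV_Plus:
  "(\<Prod>w\<in>UNIV. f w) = (\<Prod>a\<in>UNIV. f (Inl a)) * (\<Prod>b\<in>UNIV. f (Inr b))"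
  for f :: "'a::finite + 'b::finite \<Rightarrow> 'c::comm_monoid_mult"
  by (simp add: prod.Plus flip: UNIV_Plus_UNIV)

lemma diagonal_mult_vec:
  "(\<chi> u v. if u = v then d u else 0) *v y = (\<chi> u. d u * y $ u)"
  for y :: "'a::semiring_1 ^ 'n"
  by (simp add: vec_eq_iff matrix_vector_mult_def if_distrib[of "\<lambda>t. t * _"] cong: if_cong)

lemma CARD_add_pos: "real CARD('a::finite) + real CARD('b::finite) > 0"
  by (simp add: add_pos_pos)

section \<open>Laplacian and spanning trees of \<open>K(m,n)\<close> at unit weights\<close>

interpretation Kmn: finite_simple_graph "complete_bipartite :: ('m::finite + 'n::finite, 'm \<times> 'n) ugraph"
  by unfold_locales (auto simp: complete_bipartite_def inj_def doubleton_eq_iff split: prod.splits)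

definition bip_incidence :: "'m \<times> 'n \<Rightarrow> real ^ ('m::finite + 'n::finite)" where
  "bip_incidence e = axis (Inl (fst e)) 1 - axis (Inr (snd e)) 1"

text \<open>This is the inverse of \<open>L(1) + J\<close> applied to the incidence vector of \<open>e\<close>.\<close>

definition bip_potential :: "'m \<times> 'n \<Rightarrow> real ^ ('m::finite + 'n::finite)" where
  "bip_potential e = (\<chi> w. case w of
      Inl a \<Rightarrow> (of_bool (a = fst e) - 1 / (CARD('m) + CARD('n))) / CARD('n)
    | Inr b \<Rightarrow> - (of_bool (b = snd e) - 1 / (CARD('m) + CARD('n))) / CARD('m))"

text \<open>Closed form of \<open>Y(e,f)\<close>, the transfer current matrix of the network with
  unit weights.\<close>

definition transfer :: "'m::finite \<times> 'n::finite \<Rightarrow> 'm \<times> 'n \<Rightarrow> real" where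
  "transfer e f = of_bool (fst e = fst f) / CARD('n) + of_bool (snd e = snd f) / CARD('m)
     - 1 / (CARD('m) * CARD('n))"

abbreviation bip_matrix :: "('m \<times> 'n \<Rightarrow> real) \<Rightarrow> real ^ ('m::finite + 'n::finite) ^ ('m + 'n)" where
  "bip_matrix x \<equiv> laplacian complete_bipartite x + outer (\<chi> i. 1) (\<chi> i. 1)"

lemma bip_edge_weight_one:
  "edge_weight complete_bipartite (\<lambda>_. 1) u v = (case u of
      Inl a \<Rightarrow> (case v of Inl a' \<Rightarrow> 0 | Inr b \<Rightarrow> 1)
    | Inr b \<Rightarrow> (case v of Inl a \<Rightarrow> 1 | Inr b' \<Rightarrow> 0))"
proof -
  have "{e. complete_bipartite e = {Inl a, Inr b}} = {(a, b)}"
    for a :: 'a and b :: 'b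
    by (auto simp: complete_bipartite_def doubleton_eq_iff)
  moreover have "{e. complete_bipartite e = {Inr b, Inl a}} = {(a, b)}"
    for a :: 'a and b :: 'b
    by (auto simp: complete_bipartite_def doubleton_eq_iff)
  moreover have "{e. complete_bipartite e = {Inl a, Inl a' :: 'a + 'b}} = {}"
    and "{e. complete_bipartite e = {Inr b, Inr b' :: 'a + 'b}} = {}" for a a' b b'
    by (auto simp: complete_bipartite_def doubleton_eq_iff)
  ultimately show ?thesis
    by (auto simp: edge_weight_def split: sum.split)
qed

text \<open>The all-ones matrix cancels the entries -1 between the two sides and leaves, on each
  side, a multiple of the identity plus an all-ones block.\<close>

lemma bip_matrix_one:
  "bip_matrix (\<lambda>_. 1) =
    (\<chi> u v. if u = v then case u of Inl _ \<Rightarrow> real CARD('n) | Inr _ \<Rightarrow> real CARD('m) else 0)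
    + outer (\<chi> w. of_bool (isl w)) (\<chi> w. of_bool (isl w))
    + outer (\<chi> w. of_bool (\<not> isl w)) (\<chi> w. of_bool (\<not> isl w :: bool) :: real ^ ('m::finite + 'n::finite))"
  (is "?L = ?R")
  unfolding vec_eq_iff
proof (intro allI)
  fix u v :: "'m + 'n"
  show "?L $ u $ v = ?R $ u $ v"
    by (cases u; cases v)
      (simp_all add: laplacian_def outer_def bip_edge_weight_one sum_UNIV_Plus)
qed

lemma det_bip_matrix_one:
  "det (bip_matrix (\<lambda>_. 1) :: real ^ ('m::finite + 'n::finite) ^ ('m + 'n)) =
     (real CARD('m) + real CARD('n)) ^ 2 * (real CARD('m) ^ (CARD('n) - 1) * real CARD('n) ^ (CARD('m) - 1))"
proof -
  let ?D = "(\<chi> u v. if u = v then case u of Inl _ \<Rightarrow> real CARD('n) | Inr _ \<Rightarrow> real CARD('m) else 0)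
    :: real ^ ('m + 'n) ^ ('m + 'n)"
  let ?l = "(\<chi> w. of_bool (isl w)) :: real ^ ('m + 'n)"
  let ?r = "(\<chi> w. of_bool (\<not> isl w)) :: real ^ ('m + 'n)"
  have D: "det ?D = real CARD('n) ^ CARD('m) * real CARD('m) ^ CARD('n)"
    by (subst det_diagonal) (simp_all add: prod_UNIV_Plus)
  have Dl: "?D *v ((1 / CARD('n)) *\<^sub>R ?l) = ?l"
    unfolding diagonal_mult_vec by (simp add: vec_eq_iff split: sum.split)
  have Dr: "?D *v ((1 / CARD('m)) *\<^sub>R ?r) = ?r"
    unfolding diagonal_mult_vec by (simp add: vec_eq_iff split: sum.split)
  have ip: "?l \<bullet> ?l = CARD('m)" "?r \<bullet> ?r = CARD('n)" "?l \<bullet> ?r = 0"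
    by (simp_all add: inner_vec_def sum_UNIV_Plus)
  \<comment> \<open>The indicators of the two sides are orthogonal, so the first update does not
    affect the solution used for the second.\<close>
  have "(?D + outer ?l ?l) *v ((1 / CARD('m)) *\<^sub>R ?r) = ?r"
    by (simp add: matrix_vector_mult_add_rdistrib Dr outer_vec ip)
  then have "det (?D + outer ?l ?l + outer ?r ?r) =
      det ?D * (1 + CARD('m) / CARD('n)) * (1 + CARD('n) / CARD('m))"
    by (simp add: det_plus_outer det_plus_outer[OF Dl] ip)
  also have "\<dots> = (real CARD('m) + real CARD('n)) ^ 2
      * (real CARD('m) ^ (CARD('n) - 1) * real CARD('n) ^ (CARD('m) - 1))"
  proof -
    have "real CARD('n) ^ CARD('m) = real CARD('n) * real CARD('n) ^ (CARD('m) - 1)"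
      "real CARD('m) ^ CARD('n) = real CARD('m) * real CARD('m) ^ (CARD('n) - 1)"
      by (metis One_nat_def Suc_pred power_Suc zero_less_card_finite)+
    then show ?thesis
      unfolding D by (simp add: field_simps power2_eq_square)
  qed
  finally show ?thesis unfolding bip_matrix_one .
qed

lemma kirchhoff_bip_one:
  "kirchhoff (complete_bipartite :: ('m::finite + 'n::finite, 'm \<times> 'n) ugraph) (\<lambda>_. 1) =
     real CARD('m) ^ (CARD('n) - 1) * real CARD('n) ^ (CARD('m) - 1)"
proof -
  show ?thesis
    using CARD_add_pos[where 'a = 'm and 'b = 'n] Kmn.matrix_tree[of "\<lambda>_ :: 'm \<times> 'n. 1"] unfolding det_bip_matrix_one by simp
qed

lemma bip_matrix_potential: "bip_matrix (\<lambda>_. 1) *v bip_potential e = bip_incidence e"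
proof -
  \<comment> \<open>With \<open>m\<close> and \<open>n\<close> the sizes of the sides, the potential
    sums to \<open>1 / (m + n)\<close> over the left side and to minus that over the right side,
    which cancels the constants in it.\<close>
  have "(1 - real CARD('a) / (real CARD('a) + real CARD('b))) / real CARD('b)
      = 1 / (real CARD('a) + real CARD('b))"
    "1 / (real CARD('a) + real CARD('b))
      + (real CARD('b) / (real CARD('a) + real CARD('b)) - 1) / real CARD('a) = 0"
    using CARD_add_pos[where 'a = 'a and 'b = 'b] by (simp_all add: divide_simps)
  then have "(bip_matrix (\<lambda>_. 1) *v bip_potential e) $ w = bip_incidence e $ w" for w
    by (cases w) (simp_all add: bip_matrix_one matrix_vector_mult_add_rdistrib outer_vec
        diagonal_mult_vec inner_vec_def sum_UNIV_Plus bip_potential_def bip_incidence_def axis_def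
        sum_subtractf flip: sum_divide_distrib)
  then show ?thesis by (simp add: vec_eq_iff)
qed

lemma incidence_potential: "bip_incidence e \<bullet> bip_potential f = transfer e f"
proof -
  have "1 / (real CARD('a) + real CARD('b)) / CARD('b) + 1 / (real CARD('a) + real CARD('b)) / CARD('a)
      = 1 / (CARD('a) * CARD('b))"
    using CARD_add_pos[where 'a = 'a and 'b = 'b] by (simp add: divide_simps)
  then show ?thesis
    by (simp add: bip_incidence_def bip_potential_def transfer_def inner_diff_left inner_axis'
        diff_divide_distrib)
qed

section \<open>Second derivatives at the all-ones point\<close>

lemma bip_matrix_fun_upd:
  "bip_matrix (x(e := t)) = bip_matrix x + outer ((t - x e) *\<^sub>R bip_incidence e) (bip_incidence e)"
proof -
  have "complete_bipartite e = {Inl (fst e), Inr (snd e)}"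
    by (simp add: complete_bipartite_def split: prod.split)
  from laplacian_fun_upd[where g = complete_bipartite, OF this] show ?thesis
    by (simp add: bip_incidence_def)
qed

lemma transfer_sym: "transfer e f = transfer f e"
  by (simp add: transfer_def eq_commute)

lemma kirchhoff_bip_fun_upd:
  fixes e :: "'m::finite \<times> 'n::finite"
  shows "kirchhoff complete_bipartite ((\<lambda>_. 1)(e := s)) =
    kirchhoff (complete_bipartite :: ('m + 'n, 'm \<times> 'n) ugraph) (\<lambda>_. 1) * (1 + (s - 1) * transfer e e)"
proof -
  have "bip_matrix (\<lambda>_. 1) *v ((s - 1) *\<^sub>R bip_potential e) = (s - 1) *\<^sub>R bip_incidence e"
    by (simp add: matrix_vector_mult_scaleR bip_matrix_potential)
  from det_plus_outer[OF this, of "bip_incidence e"]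
  have "det (bip_matrix ((\<lambda>_. 1)(e := s))) = det (bip_matrix (\<lambda>_ :: 'm \<times> 'n. 1)) * (1 + (s - 1) * transfer e e)"
    by (simp add: bip_matrix_fun_upd incidence_potential)
  then show ?thesis
    using CARD_add_pos[where 'a = 'm and 'b = 'n] by (simp add: Kmn.matrix_tree)
qed

text \<open>The assumption \<open>nz\<close> keeps the matrix invertible after the first of the two
  rank-one updates. It holds for \<open>s\<close> near 1, which is enough for derivatives at
  1.\<close>

lemma kirchhoff_bip_fun_upd2:
  fixes e f :: "'m::finite \<times> 'n::finite"
  assumes "e \<noteq> f" and nz: "1 + (s - 1) * transfer e e \<noteq> 0"
  shows "kirchhoff complete_bipartite ((\<lambda>_. 1)(e := s, f := t)) =
    kirchhoff (complete_bipartite :: ('m + 'n, 'm \<times> 'n) ugraph) (\<lambda>_. 1) *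
      ((1 + (s - 1) * transfer e e) * (1 + (t - 1) * transfer f f)
        - (s - 1) * (t - 1) * (transfer e f)\<^sup>2)"
proof -
  have y: "bip_matrix (\<lambda>_. 1) *v (c *\<^sub>R bip_potential e) = c *\<^sub>R bip_incidence e" for e :: "'m \<times> 'n" and c
    by (simp add: matrix_vector_mult_scaleR bip_matrix_potential)
  have "1 + bip_incidence e \<bullet> ((s - 1) *\<^sub>R bip_potential e) \<noteq> 0"
    using nz by (simp add: incidence_potential)
  from det_plus_outer_outer[OF y y this, of "t - 1" f "bip_incidence f"]
  have "det (bip_matrix ((\<lambda>_. 1)(e := s, f := t))) = det (bip_matrix (\<lambda>_ :: 'm \<times> 'n. 1)) *
      ((1 + (s - 1) * transfer e e) * (1 + (t - 1) * transfer f f)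
        - (s - 1) * (t - 1) * (transfer e f)\<^sup>2)"
    using assms(1) by (simp add: bip_matrix_fun_upd incidence_potential transfer_sym[of f e] power2_eq_square mult_ac)
  then show ?thesis
    using CARD_add_pos[where 'a = 'm and 'b = 'n] by (simp add: Kmn.matrix_tree)
qed

lemma hessian_at_one_bip:
  fixes e f :: "'m::finite \<times> 'n::finite"
  shows "hessian_at_one complete_bipartite $ e $ f =
    kirchhoff (complete_bipartite :: ('m + 'n, 'm \<times> 'n) ugraph) (\<lambda>_. 1) *
      (transfer e e * transfer f f - (transfer e f)\<^sup>2)"
proof -
  let ?F = "kirchhoff (complete_bipartite :: ('m + 'n, 'm \<times> 'n) ugraph)"
  let ?c = "?F (\<lambda>_. 1)"
  have H: "hessian_at_one complete_bipartite $ e $ f =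
      deriv (\<lambda>s. partial_deriv f ?F ((\<lambda>_. 1)(e := s))) 1"
    by (simp add: hessian_at_one_def hessian_def partial_deriv_def[of e])
  show ?thesis
  proof (cases "e = f")
    case True
    \<comment> \<open>The polynomial is affine in each variable, so this derivative does not depend
      on \<open>s\<close> and the diagonal entry is 0, as the formula gives for
      \<open>e = f\<close>.\<close>
    have "partial_deriv f ?F ((\<lambda>_. 1)(e := s)) = ?c * transfer e e" for s
      unfolding partial_deriv_def True fun_upd_upd kirchhoff_bip_fun_upd
      by (rule DERIV_imp_deriv) (auto intro!: derivative_eq_intros)
    then show ?thesis unfolding H using True by (simp add: power2_eq_square)
  next
    case False
    have inner: "partial_deriv f ?F ((\<lambda>_. 1)(e := s)) =
        ?c * ((1 + (s - 1) * transfer e e) * transfer f f - (s - 1) * (transfer e f)\<^sup>2)"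
      if "1 + (s - 1) * transfer e e \<noteq> 0" for s
      unfolding partial_deriv_def kirchhoff_bip_fun_upd2[OF False that]
      by (rule DERIV_imp_deriv) (auto intro!: derivative_eq_intros)
    \<comment> \<open>The first derivative is computed only where this factor is nonzero. That set
      is open and contains 1, so it determines the derivative at 1.\<close>
    have "open {s :: real. 1 + (s - 1) * transfer e e \<noteq> 0}"
      by (intro open_Collect_neq continuous_intros)
    then have "\<forall>\<^sub>F s in nhds 1. 1 + (s - 1) * transfer e e \<noteq> 0"
      using eventually_nhds_in_open[of "{s. 1 + (s - 1) * transfer e e \<noteq> 0}" 1] by simp
    then have "deriv (\<lambda>s. partial_deriv f ?F ((\<lambda>_. 1)(e := s))) 1 =
      deriv (\<lambda>s. ?c * ((1 + (s - 1) * transfer e e) * transfer f f - (s - 1) * (transfer e f)\<^sup>2)) 1"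
      by (intro deriv_cong_ev) (auto elim!: eventually_mono simp: inner)
    also have "\<dots> = ?c * (transfer e e * transfer f f - (transfer e f)\<^sup>2)"
      by (rule DERIV_imp_deriv) (auto intro!: derivative_eq_intros)
    finally show ?thesis unfolding H .
  qed
qed

section \<open>Spectra from eigenbases\<close>

text \<open>The family has as many members as the dimension, so spanning makes it a basis. Applying
  \<open>A\<close> minus \<open>c\<close> multiplies coefficient \<open>i\<close> by
  \<open>l i - c\<close>, so an eigenvector for \<open>c\<close> has nonzero coefficients only where
  \<open>l i = c\<close>.\<close>

lemma dim_eigenspace_eigenbasis:
  fixes A :: "real ^ 'e ^ 'e" and w :: "'e \<Rightarrow> real ^ 'e"
  assumes span: "span (range w) = UNIV" and eig: "\<And>i. A *v w i = l i *\<^sub>R w i"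
  shows "dim (eigenspace A c) = card {i. l i = c}"
proof -
  have "CARD('e) \<le> card (range w)"
    using dim_le_card[of "UNIV :: (real ^ 'e) set" "range w"] span by simp
  then have "inj w"
    by (metis card_image_le eq_card_imp_inj_on finite le_antisym)
  have indep: "independent (range w)"
    by (rule card_le_dim_spanning[of _ UNIV]) (use span card_image_le[of UNIV w] in auto)
  have coeffs_zero: "k i = 0" if "(\<Sum>i\<in>UNIV. k i *\<^sub>R w i) = 0" for k i
  proof -
    have "(\<Sum>v\<in>range w. k (inv w v) *\<^sub>R v) = 0"
      using that by (simp add: sum.reindex[OF \<open>inj w\<close>] inv_f_f[OF \<open>inj w\<close>])
    with indep have "k (inv w (w i)) = 0"
      by (intro independentD[of "range w" "range w" "\<lambda>v. k (inv w v)"]) auto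
    then show ?thesis by (simp add: inv_f_f[OF \<open>inj w\<close>])
  qed
  have "eigenspace A c = span (w ` {i. l i = c})"
  proof
    show "span (w ` {i. l i = c}) \<subseteq> eigenspace A c"
    proof (rule span_minimal)
      show "subspace (eigenspace A c)"
        by (simp add: subspace_def eigenspace_def matrix_vector_right_distrib
            matrix_vector_mult_scaleR scaleR_add_right)
    qed (auto simp: eigenspace_def eig)
    show "eigenspace A c \<subseteq> span (w ` {i. l i = c})"
    proof
      fix v assume v: "v \<in> eigenspace A c"
      obtain k where k: "v = (\<Sum>i\<in>UNIV. k i *\<^sub>R w i)"
      proof -
        have "v \<in> span (range w)" using span by simp
        then obtain k where "v = (\<Sum>u\<in>range w. k u *\<^sub>R u)"
          by (auto simp: span_finite)
        then show ?thesis
          using that[of "k \<circ> w"] by (simp add: sum.reindex[OF \<open>inj w\<close>])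
      qed
      have "A *v v = (\<Sum>i\<in>UNIV. A *v (k i *\<^sub>R w i))"
        unfolding k by (rule linear_sum[OF matrix_vector_mul_linear])
      then have "(\<Sum>i\<in>UNIV. (k i * (l i - c)) *\<^sub>R w i) = A *v v - c *\<^sub>R v"
        by (simp add: k matrix_vector_mult_scaleR eig scaleR_sum_right algebra_simps sum_subtractf)
      also have "\<dots> = 0" using v by (simp add: eigenspace_def)
      finally have "k i = 0 \<or> l i = c" for i
        using coeffs_zero[of "\<lambda>i. k i * (l i - c)" i] by simp
      then have "v = (\<Sum>i | l i = c. k i *\<^sub>R w i)"
        unfolding k by (intro sum.mono_neutral_right) auto
      then show "v \<in> span (w ` {i. l i = c})"
        by (simp only:) (intro span_sum span_scale span_base; simp)
    qed
  qed
  moreover have "independent (w ` {i. l i = c})"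
    by (rule independent_mono[OF indep]) auto
  moreover have "inj_on w {i. l i = c}"
    using \<open>inj w\<close> by (rule inj_on_subset) simp
  ultimately show ?thesis
    by (simp add: dim_eq_card_independent card_image)
qed

lemma is_eigenvalue_iff_dim: "is_eigenvalue A c \<longleftrightarrow> dim (eigenspace A c) > 0"
proof -
  have "is_eigenvalue A c \<longleftrightarrow> \<not> eigenspace A c \<subseteq> {0}"
    unfolding is_eigenvalue_def eigenspace_def by auto
  also have "\<dots> \<longleftrightarrow> dim (eigenspace A c) > 0"
    by (simp only: dim_eq_0[symmetric] neq0_conv)
  finally show ?thesis .
qed

lemma has_spectrum_if_dims:
  assumes dims: "\<And>c. dim (eigenspace A c) = (\<Sum>(l, d)\<leftarrow>L. if l = c then d else 0)"
  shows "has_spectrum A L"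
proof -
  have "(\<Sum>(l, d)\<leftarrow>L. if l = c then d else 0) > (0::nat) \<longleftrightarrow> (\<exists>d>0. (c, d) \<in> set L)" for c
    by (induction L) (auto simp: case_prod_beta)
  then show ?thesis
    unfolding has_spectrum_def is_eigenvalue_iff_dim dims by simp
qed

text \<open>Tensor products of these vectors diagonalise every matrix built from the identity and the
  all-ones matrix on each factor.\<close>

definition contrast :: "'a \<Rightarrow> 'a \<Rightarrow> 'a \<Rightarrow> real" where
  "contrast a0 a x = (if a = a0 then 1 else of_bool (x = a) - of_bool (x = a0))"

lemma sum_contrast:
  fixes a :: "'a::finite"
  shows "(\<Sum>x\<in>UNIV. contrast a0 a x) = (if a = a0 then CARD('a) else 0)"
  by (simp add: contrast_def sum_subtractf)

lemma contrast_span: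
  fixes a0 a :: "'a::finite"
  shows "\<exists>c. \<forall>x. of_bool (x = a) = (\<Sum>k\<in>UNIV. c k * contrast a0 k x)"
proof (intro exI allI)
  fix x
  let ?n = "real CARD('a)"
  \<comment> \<open>The indicator of \<open>a\<close> has mean \<open>1 / ?n\<close>. The rest sums
    to zero, so it is the combination of the differences with its own values as
    coefficients.\<close>
  let ?c = "\<lambda>k. if k = a0 then 1 / ?n else of_bool (k = a) - 1 / ?n"
  have "(\<Sum>k\<in>UNIV. ?c k * contrast a0 k x) =
    1 / ?n + (\<Sum>k\<in>-{a0}. (of_bool (k = a) - 1 / ?n) * (of_bool (x = k) - of_bool (x = a0)))"
    by (subst sum.remove[of _ a0]) (auto simp: contrast_def Compl_eq_Diff_UNIV intro!: sum.cong)
  also have "(\<Sum>k\<in>-{a0}. (of_bool (k = a) - 1 / ?n) * (of_bool (x = k) - of_bool (x = a0))) =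
    (\<Sum>k\<in>UNIV. (of_bool (k = a) - 1 / ?n) * (of_bool (x = k) - of_bool (x = a0)))
      - (of_bool (a0 = a) - 1 / ?n) * (of_bool (x = a0) - of_bool (x = a0))"
    by (subst (2) sum.remove[of _ a0]) (auto simp: Compl_eq_Diff_UNIV)
  also have "(\<Sum>k\<in>UNIV. (of_bool (k = a) - 1 / ?n) * (of_bool (x = k) - of_bool (x = a0))) =
    of_bool (x = a) - 1 / ?n"
    by (simp add: algebra_simps sum.distrib sum_subtractf flip: sum_distrib_left sum_divide_distrib)
  finally show "of_bool (x = a) = (\<Sum>k\<in>UNIV. ?c k * contrast a0 k x)" by simp
qed

lemma span_contrast:
  fixes a0 :: "'a::finite" and b0 :: "'b::finite"
  shows "span (range (\<lambda>(a, b). \<chi> i. contrast a0 a (fst i) * contrast b0 b (snd i)) :: (real ^ ('a \<times> 'b)) set) = UNIV"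
    (is "span (range ?w) = _")
proof -
  have "axis i 1 \<in> span (range ?w)" for i
  proof -
    obtain c d where c: "\<And>x. of_bool (x = fst i) = (\<Sum>k\<in>UNIV. c k * contrast a0 k x)"
      and d: "\<And>x. of_bool (x = snd i) = (\<Sum>k\<in>UNIV. d k * contrast b0 k x)"
      using contrast_span by metis
    have "axis i 1 $ j = (\<Sum>k\<in>UNIV. (c (fst k) * d (snd k)) *\<^sub>R ?w k) $ j" for j
    proof -
      have "axis i 1 $ j = of_bool (fst j = fst i) * (of_bool (snd j = snd i) :: real)"
        by (auto simp: axis_def prod_eq_iff)
      also have "\<dots> = (\<Sum>k\<in>UNIV \<times> UNIV. (c (fst k) * contrast a0 (fst k) (fst j)) * (d (snd k) * contrast b0 (snd k) (snd j)))"
        unfolding c d sum_product by (simp add: sum.cartesian_product case_prod_beta)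
      also have "\<dots> = (\<Sum>k\<in>UNIV. (c (fst k) * d (snd k)) *\<^sub>R ?w k) $ j"
        by (simp add: case_prod_beta mult_ac)
      finally show ?thesis .
    qed
    then have "axis i 1 = (\<Sum>k\<in>UNIV. (c (fst k) * d (snd k)) *\<^sub>R ?w k)"
      by (simp add: vec_eq_iff)
    also have "\<dots> \<in> span (range ?w)"
      by (intro span_sum span_scale span_base rangeI)
    finally show ?thesis .
  qed
  then have "Basis \<subseteq> span (range ?w)"
    by (auto simp: Basis_vec_def)
  then show ?thesis
    using span_minimal[of Basis "span (range ?w)"] by (simp add: subspace_span top.extremum_unique)
qed

section \<open>The eigenvalues of the Hessian\<close>

lemma transfer_diag:
  "transfer e e = (real CARD('m) + real CARD('n) - 1) / (CARD('m) * CARD('n))"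
  for e :: "'m::finite \<times> 'n::finite"
  by (simp add: transfer_def field_simps)

text \<open>Indicators are idempotent, so the square stays linear in the two indicators and their
  product. The four terms are the parts along \<open>J \<otimes> J\<close>,
  \<open>I \<otimes> J\<close>, \<open>J \<otimes> I\<close> and
  \<open>I \<otimes> I\<close>.\<close>

lemma transfer_square:
  fixes e f :: "'m::finite \<times> 'n::finite"
  defines "M \<equiv> real CARD('m)" and "N \<equiv> real CARD('n)"
  shows "(transfer e f)\<^sup>2 = 1 / (M * N)\<^sup>2 + (M - 2) / (M * N\<^sup>2) * of_bool (fst f = fst e)
    + (N - 2) / (M\<^sup>2 * N) * of_bool (snd f = snd e)
    + 2 / (M * N) * (of_bool (fst f = fst e) * of_bool (snd f = snd e))"
proof -
  have pos: "M > 0" "N > 0" by (simp_all add: M_def N_def)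
  have "(A / N + B / M - 1 / (M * N))\<^sup>2 = 1 / (M * N)\<^sup>2 + (M - 2) / (M * N\<^sup>2) * A
      + (N - 2) / (M\<^sup>2 * N) * B + 2 / (M * N) * (A * B)"
    if AB: "A * A = A" "B * B = B" for A B
  proof -
    have "A / N + B / M - 1 / (M * N) = (A * M + B * N - 1) / (M * N)"
      using pos by (simp add: field_simps)
    then have "(A / N + B / M - 1 / (M * N))\<^sup>2 = (A * M + B * N - 1)\<^sup>2 / (M * N)\<^sup>2"
      by (simp add: power_divide)
    also have "(A * M + B * N - 1)\<^sup>2 = 1 + (A * A) * M\<^sup>2 - 2 * M * A + (B * B) * N\<^sup>2 - 2 * N * B + 2 * M * N * (A * B)"
      by (simp add: power2_eq_square algebra_simps)
    also have "\<dots> = 1 + M * (M - 2) * A + N * (N - 2) * B + 2 * (M * N) * (A * B)"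
      unfolding AB by (simp add: power2_eq_square algebra_simps)
    finally show ?thesis
      using pos by (simp add: add_divide_distrib power2_eq_square mult_ac)
  qed
  note square = this
  have "transfer e f = of_bool (fst f = fst e) / N + of_bool (snd f = snd e) / M - 1 / (M * N)"
    by (simp add: transfer_def M_def N_def eq_commute[of "fst e"] eq_commute[of "snd e"])
  then show ?thesis
    by (simp only:) (rule square; simp)
qed

text \<open>The action of the Hessian on a tensor product, up to a scalar; \<open>P\<close> stands
  for the product of two diagonal values of \<open>transfer\<close>, which is the same for all
  edges. Each term factors into sums over the two coordinates.\<close>

lemma sum_transfer_product:
  fixes e :: "'m::finite \<times> 'n::finite" and F :: "'m \<Rightarrow> real" and G :: "'n \<Rightarrow> real"
  defines "M \<equiv> real CARD('m)" and "N \<equiv> real CARD('n)"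
  shows "(\<Sum>f\<in>UNIV. (P - (transfer e f)\<^sup>2) * (F (fst f) * G (snd f))) =
    (P - 1 / (M * N)\<^sup>2) * (sum F UNIV * sum G UNIV)
    - (M - 2) / (M * N\<^sup>2) * (F (fst e) * sum G UNIV)
    - (N - 2) / (M\<^sup>2 * N) * (sum F UNIV * G (snd e))
    - 2 / (M * N) * (F (fst e) * G (snd e))"
proof -
  have prod: "(\<Sum>f\<in>UNIV. F' (fst f) * G' (snd f)) = sum F' UNIV * sum G' UNIV"
    for F' :: "'m \<Rightarrow> real" and G' :: "'n \<Rightarrow> real"
    by (simp add: sum_product sum.cartesian_product case_prod_beta)
  let ?d = "\<lambda>x. (of_bool (x = fst e) :: real) * F x" and ?d' = "\<lambda>y. (of_bool (y = snd e) :: real) * G y"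
  have d: "sum ?d UNIV = F (fst e)" "sum ?d' UNIV = G (snd e)" by simp_all
  have "(\<Sum>f\<in>UNIV. (P - (transfer e f)\<^sup>2) * (F (fst f) * G (snd f))) =
    (\<Sum>f\<in>UNIV. (P - 1 / (M * N)\<^sup>2) * (F (fst f) * G (snd f))
      - (M - 2) / (M * N\<^sup>2) * (?d (fst f) * G (snd f))
      - (N - 2) / (M\<^sup>2 * N) * (F (fst f) * ?d' (snd f))
      - 2 / (M * N) * (?d (fst f) * ?d' (snd f)))"
    by (rule sum.cong[OF refl]) (simp add: transfer_square flip: M_def N_def, simp add: algebra_simps)
  also have "\<dots> = (P - 1 / (M * N)\<^sup>2) * (sum F UNIV * sum G UNIV)
      - (M - 2) / (M * N\<^sup>2) * (sum ?d UNIV * sum G UNIV)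
      - (N - 2) / (M\<^sup>2 * N) * (sum F UNIV * sum ?d' UNIV)
      - 2 / (M * N) * (sum ?d UNIV * sum ?d' UNIV)"
    unfolding sum_subtractf sum_distrib_left[symmetric] prod prod[of ?d G] prod[of F ?d'] prod[of ?d ?d'] ..
  finally show ?thesis unfolding d .
qed

text \<open>A contrast vector is constant or sums to zero, so its sum is the cardinality times its
  value or 0. This decides which of the four terms of \<open>sum_transfer_product\<close>
  survive.\<close>

lemma hessian_bip_contrast:
  fixes a0 a :: "'m::finite" and b0 b :: "'n::finite"
  defines "M \<equiv> real CARD('m)" and "N \<equiv> real CARD('n)"
  defines "t \<equiv> M ^ (CARD('n) - 1) * N ^ (CARD('m) - 1)"
  defines "w \<equiv> (\<chi> i. contrast a0 a (fst i) * contrast b0 b (snd i)) :: real ^ ('m \<times> 'n)"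
  shows "hessian_at_one complete_bipartite *v w =
    (if a = a0 then if b = b0 then t / (M * N) * ((M + N - 1) * (M + N - 2)) else - t / M
     else if b = b0 then - t / N else - 2 * t / (M * N)) *\<^sub>R w"
    (is "_ = ?l *\<^sub>R w")
proof -
  have pos: "M > 0" "N > 0" by (simp_all add: M_def N_def)
  have "(hessian_at_one complete_bipartite *v w) $ e = ?l * w $ e" for e
  proof -
    let ?F = "contrast a0 a" and ?G = "contrast b0 b"
    let ?P = "((M + N - 1) / (M * N))\<^sup>2"
    have "(hessian_at_one complete_bipartite *v w) $ e =
      (\<Sum>f\<in>UNIV. t * ((?P - (transfer e f)\<^sup>2) * (?F (fst f) * ?G (snd f))))"
      by (simp add: matrix_vector_mult_def hessian_at_one_bip kirchhoff_bip_one transfer_diag w_def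
          t_def M_def N_def power2_eq_square mult.assoc)
    also have "\<dots> = t * ((?P - 1 / (M * N)\<^sup>2) * (sum ?F UNIV * sum ?G UNIV)
      - (M - 2) / (M * N\<^sup>2) * (?F (fst e) * sum ?G UNIV)
      - (N - 2) / (M\<^sup>2 * N) * (sum ?F UNIV * ?G (snd e))
      - 2 / (M * N) * (?F (fst e) * ?G (snd e)))"
      unfolding sum_distrib_left[symmetric] sum_transfer_product M_def N_def ..
    also have "\<dots> = ?l * (?F (fst e) * ?G (snd e))"
    proof -
      have F: "sum ?F UNIV = (if a = a0 then M else 0)" "a = a0 \<Longrightarrow> ?F x = 1" for x
        by (simp add: sum_contrast M_def) (simp add: contrast_def)
      have G: "sum ?G UNIV = (if b = b0 then N else 0)" "b = b0 \<Longrightarrow> ?G x = 1" for x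
        by (simp add: sum_contrast N_def) (simp add: contrast_def)
      show ?thesis
        using pos F(2) G(2) unfolding F(1) G(1)
        by (cases "a = a0"; cases "b = b0") (simp_all add: field_simps power2_eq_square)
    qed
    finally show ?thesis by (simp add: w_def)
  qed
  then show ?thesis by (simp add: vec_eq_iff)
qed

section \<open>Multiplicities and exponents\<close>

lemma sum_if_eq_UNIV:
  "(\<Sum>b\<in>UNIV. if b = b0 then x else y) = x + (CARD('b) - 1) * y"
  for b0 :: "'b::finite" and x y :: nat
proof -
  have "(\<Sum>b\<in>UNIV. if b = b0 then x else y) = x + (\<Sum>b\<in>UNIV - {b0}. if b = b0 then x else y)"
    by (subst sum.remove[of _ b0]) simp_all
  also have "(\<Sum>b\<in>UNIV - {b0}. if b = b0 then x else y) = (\<Sum>b\<in>UNIV - {b0}. y)"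
    by (rule sum.cong) auto
  finally show ?thesis by simp
qed

lemma card_pairs_if:
  fixes a0 :: "'a::finite" and b0 :: "'b::finite"
  shows "card {i. (case i of (a, b) \<Rightarrow>
      if a = a0 then if b = b0 then w else x else if b = b0 then y else z) = c} =
    of_bool (w = c) + (CARD('b) - 1) * of_bool (x = c)
    + (CARD('a) - 1) * (of_bool (y = c) + (CARD('b) - 1) * of_bool (z = c))"
    (is "card {i. ?l i = c} = _")
proof -
  have "card {i. ?l i = c} = (\<Sum>i\<in>UNIV. of_bool (?l i = c))"
    by simp
  also have "\<dots> = (\<Sum>a\<in>UNIV. \<Sum>b\<in>UNIV. of_bool (?l (a, b) = c))"
    unfolding sum.cartesian_product by (rule sum.cong) auto
  also have "\<dots> = (\<Sum>a\<in>UNIV. if a = a0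
      then \<Sum>b\<in>UNIV. if b = b0 then of_bool (w = c) else of_bool (x = c)
      else \<Sum>b\<in>UNIV. if b = b0 then of_bool (y = c) else of_bool (z = c))"
  proof (rule sum.cong[OF refl])
    show "(\<Sum>b\<in>UNIV. of_bool (?l (a, b) = c)) = (if a = a0
      then \<Sum>b\<in>UNIV. if b = b0 then of_bool (w = c) else of_bool (x = c)
      else \<Sum>b\<in>UNIV. if b = b0 then of_bool (y = c) else (of_bool (z = c) :: nat))" for a
      by (cases "a = a0"; simp only: if_True if_False simp_thms prod.case; rule sum.cong) auto
  qed
  finally show ?thesis unfolding sum_if_eq_UNIV .
qed

text \<open>For \<open>k = 1\<close> the exponent \<open>k - 2\<close> is negative; dividing by
  \<open>x\<close> brings the integer power back to a natural exponent.\<close>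

lemma power_int_minus_nat:
  fixes x :: real
  assumes "x \<noteq> 0" "k \<ge> 1"
  shows "x powi (int k - 1) = x ^ (k - 1)" "x powi (int k - 2) = x ^ (k - 1) / x"
proof -
  have "int k - 1 = int (k - 1)" using assms by simp
  then show 1: "x powi (int k - 1) = x ^ (k - 1)" by (simp only: power_int_of_nat)
  have "x powi (int k - 2) = x powi ((int k - 1) - 1)" by simp
  also have "\<dots> = x ^ (k - 1) / x"
    using assms(1) by (subst power_int_diff) (simp_all add: 1)
  finally show "x powi (int k - 2) = x ^ (k - 1) / x" .
qed

theorem theorem3p17:
  fixes m n :: nat
  assumes "m = CARD('m::finite)" and "n = CARD('n::finite)"
    and "m \<ge> 1" and "n \<ge> 1" and "m + n \<ge> 3"
  shows "has_spectrum
    (hessian_at_one (complete_bipartite :: ('m + 'n, 'm \<times> 'n) ugraph))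
    [(- 2 * real m powi (int n - 2) * real n powi (int m - 2), (m - 1) * (n - 1)),
     (- (real m powi (int n - 2) * real n powi (int m - 1)), n - 1),
     (- (real m powi (int n - 1) * real n powi (int m - 2)), m - 1),
     (real m powi (int n - 2) * real n powi (int m - 2)
        * (real m + real n - 1) * (real m + real n - 2), 1)]"
proof (rule has_spectrum_if_dims)
  fix c :: real
  fix a0 :: 'm and b0 :: 'n
  let ?H = "hessian_at_one (complete_bipartite :: ('m + 'n, 'm \<times> 'n) ugraph)"
  let ?w = "\<lambda>(a, b). (\<chi> i. contrast a0 a (fst i) * contrast b0 b (snd i)) :: real ^ ('m \<times> 'n)"
  \<comment> \<open>\<open>t\<close> is the number of spanning trees. All eigenvalues are multiples
    of it, the common factor \<open>m^(n-2) n^(m-2)\<close> being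
    \<open>t / (m * n)\<close>.\<close>
  define t where "t = real m ^ (n - 1) * real n ^ (m - 1)"
  define l1 where "l1 = - 2 * t / (real m * real n)"
  define l2 where "l2 = - t / real m"
  define l3 where "l3 = - t / real n"
  define l4 where "l4 = t / (real m * real n) * ((real m + real n - 1) * (real m + real n - 2))"
  let ?l = "\<lambda>(a, b). if a = a0 then if b = b0 then l4 else l2 else if b = b0 then l3 else l1"
  have "?H *v ?w i = ?l i *\<^sub>R ?w i" for i
    using hessian_bip_contrast[of a0 "fst i" b0 "snd i"]
    by (simp add: case_prod_beta l1_def l2_def l3_def l4_def t_def assms(1,2))
  then have "dim (eigenspace ?H c) = card {i. ?l i = c}"
    by (rule dim_eigenspace_eigenbasis[OF span_contrast])
  also have "\<dots> = (\<Sum>(l, d)\<leftarrow>[(l1, (m - 1) * (n - 1)), (l2, n - 1), (l3, m - 1), (l4, 1)].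
      if l = c then d else 0)"
    unfolding card_pairs_if by (simp add: assms(1,2) distrib_left)
  also have "[(l1, (m - 1) * (n - 1)), (l2, n - 1), (l3, m - 1), (l4, 1)] =
    [(- 2 * real m powi (int n - 2) * real n powi (int m - 2), (m - 1) * (n - 1)),
     (- (real m powi (int n - 2) * real n powi (int m - 1)), n - 1),
     (- (real m powi (int n - 1) * real n powi (int m - 2)), m - 1),
     (real m powi (int n - 2) * real n powi (int m - 2)
        * (real m + real n - 1) * (real m + real n - 2), 1)]"
    using assms(3,4) by (simp add: power_int_minus_nat l1_def l2_def l3_def l4_def t_def)
  finally show "dim (eigenspace ?H c) = (\<Sum>(l, d)\<leftarrow>[
     (- 2 * real m powi (int n - 2) * real n powi (int m - 2), (m - 1) * (n - 1)),
     (- (real m powi (int n - 2) * real n powi (int m - 1)), n - 1),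
     (- (real m powi (int n - 1) * real n powi (int m - 2)), m - 1),
     (real m powi (int n - 2) * real n powi (int m - 2)
        * (real m + real n - 1) * (real m + real n - 2), 1)]. if l = c then d else 0)" .
qed

end
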